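(* Let $\mathsf G$ be a ground g-choreography, $\Pi\subseteq\mathcal P$ and $\phi,\Lambda\subseteq\mathcal L$. If the judgement $\Pi\vdash\mathsf G:\langle\phi,\Lambda\rangle$ is derivable, then $[\![\mathsf G]\!]\neq\bot$, $\Pi=\mathcal P(\mathsf G)$, and for every participant $\mathsf A\in\Pi$ $$\widehat{\phi}(\mathsf A)=\min\big([\![\mathsf G]\!]\!\downarrow\!\mathsf A\big)\qquad\text{and}\qquad \widehat{\Lambda}(\mathsf A)=\max\big([\![\mathsf G]\!]\!\downarrow\!\mathsf A\big).$$
   Context: Fix a set $\mathcal P$ of participants and a set $\mathcal M$ of messages. Ground g-choreographies are generated by $\mathsf G::=\mathbf 0\mid \mathsf A\to\mathsf B:m\mid \mathsf G;\mathsf G\mid \mathsf G\,|\,\mathsf G\mid \mathsf G+\mathsf G$ (empty, interaction with $\mathsf A\neq\mathsf B$, sequential composition, parallel composition, choice); $\mathcal P(\mathsf G)$ is the set of participants occurring in $\mathsf G$. Labels: $\mathcal L^!=\{\mathsf{AB}!m\}$ (outputs), $\mathcal L^?=\{\mathsf{AB}?m\}$ (inputs), $\mathcal L=\mathcal L^!\cup\mathcal L^?$, for $\mathsf A\neq\mathsf B\in\mathcal P$, $m\in\mathcal M$. The subject is $\mathrm{sbj}(\mathsf{AB}!m)=\mathsf A$, $\mathrm{sbj}(\mathsf{AB}?m)=\mathsf B$; for a set of labels $L$, $\mathrm{sbj}(L)$ is the set of subjects. For $L\subseteq\mathcal L$ and $\mathsf A\in\mathcal P$, $\widehat L(\mathsf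 A)=\{\ell\in L\mid \mathrm{sbj}(\ell)=\mathsf A\}$, and for $\Pi\subseteq\mathcal P$, $L-\Pi=\{\ell\in L\mid\mathrm{sbj}(\ell)\notin\Pi\}$. A labelled event structure is $\mathcal E=(E,\le,\#,\lambda)$ with $\le$ a partial order, $\#$ an irreflexive symmetric hereditary conflict relation ($e\#e'\le e''\Rightarrow e\#e''$), $\lambda:E\to\mathcal L$; $\epsilon$ is the empty one. A configuration is a conflict-free, $\le$-downward-closed set of events; $\mathrm{MaxC}(\mathcal E)$ is the set of inclusion-maximal configurations. The projection $\mathcal E\!\downarrow\!\mathsf A$ (and $x\!\downarrow\!\mathsf A$ for a set of events $x$) is the restriction to the events whose label has subject $\mathsf A$. $\min(\cdot)$ and $\max(\cdot)$ denote the sets of labels of the $\le$-minimal, resp. $\le$-maximal, events (events are identified with their labels). Semantics $[\![\mathsf G]\!]$ (an event structure or $\bot$; $\bot$ propagates through all constructors): $[\![\mathbf 0]\!]=\epsilon$; $[\![\mathsf A\to\mathsf B:m]\!]$ has two events $e_1<e_2$, no conflict, $\lambda(e_1)=\mathsf{AB}!m$, $\lambda(e_2)=\mathsf{AB}?m$. $[\![\mathsf G_1|\mathsf G_2]\!]=[\![\mathsf G_1]\!]\otimes[\![\mathsf G_2]\!]$, the disjoint union (union of orders, conflicts and labellings), defined only when the label sets of the two are disjoint, otherwise $\bot$. $[\![\mathsf G_1;\mathsf G_2]\!]$: with $\mathcal E_i=[\![\mathsf G_i]\!]$, take for each $x\in\mathrm{MaxC}(\mathcal E_1)$ a fresh disjoint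 copy $\mathcal E_x$ of $\mathcal E_2$; the events are $E_1\cup\bigcup_x E_x$, the order is generated by $\le_1\cup\bigcup_x(\le_x\cup\{(e_1,e_2)\in x\times E_x\mid \mathrm{sbj}(\lambda_1(e_1))=\mathrm{sbj}(\lambda_x(e_2))\})$, and conflict is generated by $\#_1$, the $\#_x$, all pairs of events in distinct copies, and all pairs $(e_1,e_2)$ with $e_2\in E_x$, $e_1\in E_1\setminus x$. $[\![\mathsf G_1+\mathsf G_2]\!]=[\![\mathsf G_1]\!]+[\![\mathsf G_2]\!]$ (disjoint union with every event of one in conflict with every event of the other), defined only if the two are well-branched, otherwise $\bot$: there is exactly one participant $\mathsf A$ (the active one) such that $\min(\mathcal E_1\!\downarrow\!\mathsf A)$ and $\min(\mathcal E_2\!\downarrow\!\mathsf A)$ are non-empty disjoint subsets of $\mathcal L^!$, and every other participant $\mathsf B$ is passive: $\min(\mathcal E_1\!\downarrow\!\mathsf B)$, $\min(\mathcal E_2\!\downarrow\!\mathsf B)$ are disjoint subsets of $\mathcal L^?$, one empty iff the other is. $\mathsf G$ is well-formed iff $[\![\mathsf G]\!]\neq\bot$. Typing rules for judgements $\Pi\vdash\mathsf G:\langle\phi,\Lambda\rangle$ ($\Pi\subseteq\mathcal P$, $\phi,\Lambda\subseteq\mathcal L$): (t-emp) $\emptyset\vdash\mathbf 0:\langle\emptyset,\emptyset\rangle$. (t-int) $\{\mathsf A,\mathsf B\}\vdash\mathsf A\to\mathsf B:m:\langle\phi,\phi\rangle$ with $\phi=\{\mathsf{AB}!m,\mathsf{AB}?m\}$.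 (t-seq) from $\Pi_i\vdash\mathsf G_i:\langle\phi_i,\Lambda_i\rangle$ ($i=1,2$) infer $\Pi_1\cup\Pi_2\vdash\mathsf G_1;\mathsf G_2:\langle\phi_1\cup(\phi_2-\Pi_1),\Lambda_2\cup(\Lambda_1-\Pi_2)\rangle$. (t-par) from $\Pi_i\vdash\mathsf G_i:\langle\phi_i,\Lambda_i\rangle$ and $\Pi_1\cap\Pi_2=\emptyset$ infer $\Pi_1\cup\Pi_2\vdash\mathsf G_1|\mathsf G_2:\langle\phi_1\cup\phi_2,\Lambda_1\cup\Lambda_2\rangle$. (t-ch) from $\Pi\vdash\mathsf G_i:\langle\phi_i,\Lambda_i\rangle$ ($i=1,2$, same $\Pi$) and the condition: (1) there is a unique $\mathsf A\in\Pi$ with $\widehat{\phi_1}(\mathsf A),\widehat{\phi_2}(\mathsf A)$ non-empty, disjoint and with union $\subseteq\mathcal L^!$; (2) for all $\mathsf B\in\Pi\setminus\{\mathsf A\}$, $\widehat{\phi_1}(\mathsf B),\widehat{\phi_2}(\mathsf B)$ are disjoint with union $\subseteq\mathcal L^?$, and $\widehat{\phi_1}(\mathsf B)=\emptyset$ iff $\widehat{\phi_2}(\mathsf B)=\emptyset$; infer $\Pi\vdash\mathsf G_1+\mathsf G_2:\langle\phi_1\cup\phi_2,\Lambda_1\cup\Lambda_2\rangle$. *)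

theory Defs
  imports Main "HOL-Library.FSet"
begin

text \<open>
  The participants and the messages are the elements of the types \<open>'p\<close> and \<open>'m\<close>.
\<close>

section \<open>Ground g-choreographies and labels\<close>

datatype ('p, 'm) gchor =
    Emp
  | Interact 'p 'p 'm
  | Seq "('p, 'm) gchor" "('p, 'm) gchor"
  | Par "('p, 'm) gchor" "('p, 'm) gchor"
  | Choice "('p, 'm) gchor" "('p, 'm) gchor"

text \<open>
  The side condition of the grammar (sender and receiver differ) is kept as a predicate: a
  type of pairs of distinct participants would be empty when \<open>'p\<close> has a single element.
\<close>

primrec ground :: "('p, 'm) gchor \<Rightarrow> bool" where
  "ground Emp = True"
| "ground (Interact A B m) = (A \<noteq> B)"
| "ground (Seq G H) = (ground G \<and> ground H)"
| "ground (Par G H) = (ground G \<and> ground H)"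
| "ground (Choice G H) = (ground G \<and> ground H)"

primrec participants :: "('p, 'm) gchor \<Rightarrow> 'p set" where
  "participants Emp = {}"
| "participants (Interact A B m) = {A, B}"
| "participants (Seq G H) = participants G \<union> participants H"
| "participants (Par G H) = participants G \<union> participants H"
| "participants (Choice G H) = participants G \<union> participants H"

datatype ('p, 'm) label = Out 'p 'p 'm | Inp 'p 'p 'm

definition outputs :: "('p, 'm) label set" where
  "outputs = {Out A B m | A B m. A \<noteq> B}"

definition inputs :: "('p, 'm) label set" where
  "inputs = {Inp A B m | A B m. A \<noteq> B}"

definition labels :: "('p, 'm) label set" where
  "labels = outputs \<union> inputs"

primrec sbj :: "('p, 'm) label \<Rightarrow> 'p" where
  "sbj (Out A B m) = A"
| "sbj (Inp A B m) = B"

text \<open>\<open>restrict_to L A\<close> is the hat notation $\widehat L(A)$; \<open>remove_sbj L P\<close> is $L - P$.\<close>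

definition restrict_to :: "('p, 'm) label set \<Rightarrow> 'p \<Rightarrow> ('p, 'm) label set" where
  "restrict_to L A = {l \<in> L. sbj l = A}"

definition remove_sbj :: "('p, 'm) label set \<Rightarrow> 'p set \<Rightarrow> ('p, 'm) label set" where
  "remove_sbj L P = {l \<in> L. sbj l \<notin> P}"


section \<open>Labelled event structures\<close>

text \<open>The value of \<open>lab\<close> is irrelevant outside \<open>events\<close>.\<close>

record ('e, 'p, 'm) les =
  events :: "'e set"
  le :: "('e \<times> 'e) set"
  conflict :: "('e \<times> 'e) set"
  lab :: "'e \<Rightarrow> ('p, 'm) label"

definition configuration :: "('e, 'p, 'm) les \<Rightarrow> 'e set \<Rightarrow> bool" where
  "configuration E x \<longleftrightarrow>
     x \<subseteq> events E \<and>
     (\<forall>e\<in>x. \<forall>e'\<in>x. (e, e') \<notin> conflict E) \<and>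
     (\<forall>e\<in>x. \<forall>e'\<in>events E. (e', e) \<in> le E \<longrightarrow> e' \<in> x)"

definition MaxC :: "('e, 'p, 'm) les \<Rightarrow> 'e set set" where
  "MaxC E = {x. configuration E x \<and> (\<forall>y. configuration E y \<longrightarrow> x \<subseteq> y \<longrightarrow> y = x)}"

definition proj :: "('e, 'p, 'm) les \<Rightarrow> 'p \<Rightarrow> ('e, 'p, 'm) les" where
  "proj E A =
     (let F = {e \<in> events E. sbj (lab E e) = A}
      in \<lparr> events = F, le = le E \<inter> F \<times> F, conflict = conflict E \<inter> F \<times> F, lab = lab E \<rparr>)"

definition min_labels :: "('e, 'p, 'm) les \<Rightarrow> ('p, 'm) label set" where
  "min_labels E = lab E ` {e \<in> events E. \<forall>e'\<in>events E. (e', e) \<in> le E \<longrightarrow> e' = e}"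

definition max_labels :: "('e, 'p, 'm) les \<Rightarrow> ('p, 'm) label set" where
  "max_labels E = lab E ` {e \<in> events E. \<forall>e'\<in>events E. (e, e') \<in> le E \<longrightarrow> e' = e}"

definition gen_order :: "'e set \<Rightarrow> ('e \<times> 'e) set \<Rightarrow> ('e \<times> 'e) set" where
  "gen_order E R = (Id_on E \<union> R)\<^sup>+"

text \<open>The least symmetric relation containing \<open>R\<close> that is hereditary with respect to \<open>le\<close>.\<close>

inductive_set gen_conflict :: "('e \<times> 'e) set \<Rightarrow> ('e \<times> 'e) set \<Rightarrow> ('e \<times> 'e) set"
  for le :: "('e \<times> 'e) set" and R :: "('e \<times> 'e) set"
where
  base: "(e, e') \<in> R \<Longrightarrow> (e, e') \<in> gen_conflict le R"
| sym: "(e, e') \<in> gen_conflict le R \<Longrightarrow> (e', e) \<in> gen_conflict le R"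
| hereditary: "(e, e') \<in> gen_conflict le R \<Longrightarrow> (e', e'') \<in> le \<Longrightarrow> (e, e'') \<in> gen_conflict le R"


section \<open>Semantics\<close>

text \<open>
  A single type of events, closed under the disjoint unions used by the semantics:
  \<open>EvL\<close> and \<open>EvR\<close> tag the two sides, and \<open>EvCopy x e\<close> is the event \<open>e\<close> in the fresh copy
  belonging to the maximal configuration \<open>x\<close>. Configurations are stored as finite sets
  because a datatype cannot recurse through arbitrary sets; nothing is lost, since every
  event structure in the range of the semantics is finite (lemma \<open>finite_events_sem\<close>).
\<close>

datatype ev = EvOut | EvInp | EvL ev | EvR ev | EvCopy "ev fset" ev

type_synonym ('p, 'm) es = "(ev, 'p, 'm) les"

fun join_lab :: "(ev \<Rightarrow> ('p, 'm) label) \<Rightarrow> (ev \<Rightarrow> ('p, 'm) label) \<Rightarrow> ev \<Rightarrow> ('p, 'm) label" where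
  "join_lab l1 l2 (EvL e) = l1 e"
| "join_lab l1 l2 (EvR e) = l2 e"
| "join_lab l1 l2 (EvCopy x e) = l2 e"
| "join_lab l1 l2 e = undefined"

definition empty_es :: "('p, 'm) es" where
  "empty_es = \<lparr> events = {}, le = {}, conflict = {}, lab = (\<lambda>_. undefined) \<rparr>"

definition int_es :: "'p \<Rightarrow> 'p \<Rightarrow> 'm \<Rightarrow> ('p, 'm) es" where
  "int_es A B m =
     \<lparr> events = {EvOut, EvInp},
       le = {(EvOut, EvOut), (EvInp, EvInp), (EvOut, EvInp)},
       conflict = {},
       lab = (\<lambda>e. if e = EvOut then Out A B m else Inp A B m) \<rparr>"

definition par_es :: "('p, 'm) es \<Rightarrow> ('p, 'm) es \<Rightarrow> ('p, 'm) es" where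
  "par_es E1 E2 =
     \<lparr> events = EvL ` events E1 \<union> EvR ` events E2,
       le = map_prod EvL EvL ` le E1 \<union> map_prod EvR EvR ` le E2,
       conflict = map_prod EvL EvL ` conflict E1 \<union> map_prod EvR EvR ` conflict E2,
       lab = join_lab (lab E1) (lab E2) \<rparr>"

definition choice_es :: "('p, 'm) es \<Rightarrow> ('p, 'm) es \<Rightarrow> ('p, 'm) es" where
  "choice_es E1 E2 =
     \<lparr> events = EvL ` events E1 \<union> EvR ` events E2,
       le = map_prod EvL EvL ` le E1 \<union> map_prod EvR EvR ` le E2,
       conflict = map_prod EvL EvL ` conflict E1 \<union> map_prod EvR EvR ` conflict E2
                  \<union> (EvL ` events E1) \<times> (EvR ` events E2)
                  \<union> (EvR ` events E2) \<times> (EvL ` events E1),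
       lab = join_lab (lab E1) (lab E2) \<rparr>"

definition seq_events :: "('p, 'm) es \<Rightarrow> ('p, 'm) es \<Rightarrow> ev set" where
  "seq_events E1 E2 =
     EvL ` events E1 \<union> {EvCopy x e | x e. fset x \<in> MaxC E1 \<and> e \<in> events E2}"

definition seq_le :: "('p, 'm) es \<Rightarrow> ('p, 'm) es \<Rightarrow> (ev \<times> ev) set" where
  "seq_le E1 E2 =
     gen_order (seq_events E1 E2)
       (map_prod EvL EvL ` le E1
        \<union> {(EvCopy x e, EvCopy x e') | x e e'. fset x \<in> MaxC E1 \<and> (e, e') \<in> le E2}
        \<union> {(EvL e1, EvCopy x e2) | x e1 e2. fset x \<in> MaxC E1 \<and> e1 \<in> fset x \<and> e2 \<in> events E2 \<and>
             sbj (lab E1 e1) = sbj (lab E2 e2)})"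

definition seq_conflict :: "('p, 'm) es \<Rightarrow> ('p, 'm) es \<Rightarrow> (ev \<times> ev) set" where
  "seq_conflict E1 E2 =
     gen_conflict (seq_le E1 E2)
       (map_prod EvL EvL ` conflict E1
        \<union> {(EvCopy x e, EvCopy x e') | x e e'. fset x \<in> MaxC E1 \<and> (e, e') \<in> conflict E2}
        \<union> {(EvCopy x e, EvCopy y e') | x y e e'. fset x \<in> MaxC E1 \<and> fset y \<in> MaxC E1 \<and> x \<noteq> y \<and>
             e \<in> events E2 \<and> e' \<in> events E2}
        \<union> {(EvL e1, EvCopy x e2) | x e1 e2. fset x \<in> MaxC E1 \<and> e1 \<in> events E1 - fset x \<and>
             e2 \<in> events E2})"

definition seq_es :: "('p, 'm) es \<Rightarrow> ('p, 'm) es \<Rightarrow> ('p, 'm) es" where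
  "seq_es E1 E2 =
     \<lparr> events = seq_events E1 E2,
       le = seq_le E1 E2,
       conflict = seq_conflict E1 E2,
       lab = join_lab (lab E1) (lab E2) \<rparr>"

definition active_part :: "('p, 'm) es \<Rightarrow> ('p, 'm) es \<Rightarrow> 'p \<Rightarrow> bool" where
  "active_part E1 E2 A \<longleftrightarrow>
     min_labels (proj E1 A) \<noteq> {} \<and> min_labels (proj E2 A) \<noteq> {} \<and>
     min_labels (proj E1 A) \<inter> min_labels (proj E2 A) = {} \<and>
     min_labels (proj E1 A) \<subseteq> outputs \<and> min_labels (proj E2 A) \<subseteq> outputs"

definition passive_part :: "('p, 'm) es \<Rightarrow> ('p, 'm) es \<Rightarrow> 'p \<Rightarrow> bool" where
  "passive_part E1 E2 B \<longleftrightarrow>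
     min_labels (proj E1 B) \<inter> min_labels (proj E2 B) = {} \<and>
     min_labels (proj E1 B) \<subseteq> inputs \<and> min_labels (proj E2 B) \<subseteq> inputs \<and>
     (min_labels (proj E1 B) = {} \<longleftrightarrow> min_labels (proj E2 B) = {})"

definition well_branched :: "('p, 'm) es \<Rightarrow> ('p, 'm) es \<Rightarrow> bool" where
  "well_branched E1 E2 \<longleftrightarrow>
     (\<exists>A. active_part E1 E2 A \<and> (\<forall>A'. active_part E1 E2 A' \<longrightarrow> A' = A) \<and>
          (\<forall>B. B \<noteq> A \<longrightarrow> passive_part E1 E2 B))"

text \<open>\<open>None\<close> is the undefined semantics $\bot$.\<close>

primrec sem :: "('p, 'm) gchor \<Rightarrow> ('p, 'm) es option" where
  "sem Emp = Some empty_es"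
| "sem (Interact A B m) = Some (int_es A B m)"
| "sem (Seq G H) =
     Option.bind (sem G) (\<lambda>E1. Option.bind (sem H) (\<lambda>E2. Some (seq_es E1 E2)))"
| "sem (Par G H) =
     Option.bind (sem G) (\<lambda>E1. Option.bind (sem H) (\<lambda>E2.
       if lab E1 ` events E1 \<inter> lab E2 ` events E2 = {} then Some (par_es E1 E2) else None))"
| "sem (Choice G H) =
     Option.bind (sem G) (\<lambda>E1. Option.bind (sem H) (\<lambda>E2.
       if well_branched E1 E2 then Some (choice_es E1 E2) else None))"

lemma finite_events_sem: "sem G = Some E \<Longrightarrow> finite (events E)"
proof (induction G arbitrary: E)
  case Emp
  then show ?case by (auto simp: empty_es_def)
next
  case (Interact A B m)
  then show ?case by (auto simp: int_es_def)
next
  case (Seq G H)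
  then obtain E1 E2 where E: "sem G = Some E1" "sem H = Some E2" "E = seq_es E1 E2"
    by (auto simp: bind_eq_Some_conv)
  have fin: "finite (events E1)" "finite (events E2)"
    using Seq.IH E by auto
  have "fset ` {x. fset x \<in> MaxC E1} \<subseteq> Pow (events E1)"
    by (auto simp: MaxC_def configuration_def)
  then have "finite (fset ` {x. fset x \<in> MaxC E1})"
    using fin(1) finite_subset by blast
  then have "finite {x. fset x \<in> MaxC E1}"
    by (rule finite_imageD) (auto simp: inj_on_def fset_inject)
  then have "finite ((\<lambda>(x, e). EvCopy x e) ` ({x. fset x \<in> MaxC E1} \<times> events E2))"
    using fin(2) by blast
  moreover have "{EvCopy x e | x e. fset x \<in> MaxC E1 \<and> e \<in> events E2}
      = (\<lambda>(x, e). EvCopy x e) ` ({x. fset x \<in> MaxC E1} \<times> events E2)"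
    by auto
  ultimately show ?case
    using E(3) fin(1) by (simp add: seq_es_def seq_events_def)
next
  case (Par G H)
  then show ?case by (auto simp: bind_eq_Some_conv par_es_def split: if_splits)
next
  case (Choice G H)
  then show ?case by (auto simp: bind_eq_Some_conv choice_es_def split: if_splits)
qed


section \<open>Typing\<close>

definition ch_active :: "('p, 'm) label set \<Rightarrow> ('p, 'm) label set \<Rightarrow> 'p \<Rightarrow> bool" where
  "ch_active \<phi>1 \<phi>2 A \<longleftrightarrow>
     restrict_to \<phi>1 A \<noteq> {} \<and> restrict_to \<phi>2 A \<noteq> {} \<and>
     restrict_to \<phi>1 A \<inter> restrict_to \<phi>2 A = {} \<and>
     restrict_to \<phi>1 A \<union> restrict_to \<phi>2 A \<subseteq> outputs"

definition ch_passive :: "('p, 'm) label set \<Rightarrow> ('p, 'm) label set \<Rightarrow> 'p \<Rightarrow> bool" where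
  "ch_passive \<phi>1 \<phi>2 B \<longleftrightarrow>
     restrict_to \<phi>1 B \<inter> restrict_to \<phi>2 B = {} \<and>
     restrict_to \<phi>1 B \<union> restrict_to \<phi>2 B \<subseteq> inputs \<and>
     (restrict_to \<phi>1 B = {} \<longleftrightarrow> restrict_to \<phi>2 B = {})"

definition ch_cond :: "'p set \<Rightarrow> ('p, 'm) label set \<Rightarrow> ('p, 'm) label set \<Rightarrow> bool" where
  "ch_cond P \<phi>1 \<phi>2 \<longleftrightarrow>
     (\<exists>A\<in>P. ch_active \<phi>1 \<phi>2 A \<and> (\<forall>A'\<in>P. ch_active \<phi>1 \<phi>2 A' \<longrightarrow> A' = A) \<and>
            (\<forall>B\<in>P - {A}. ch_passive \<phi>1 \<phi>2 B))"

inductive typed ::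
    "'p set \<Rightarrow> ('p, 'm) gchor \<Rightarrow> ('p, 'm) label set \<Rightarrow> ('p, 'm) label set \<Rightarrow> bool"
    ("_ \<turnstile> _ : \<langle>_, _\<rangle>" [51, 51, 0, 0] 50)
where
  t_emp: "{} \<turnstile> Emp : \<langle>{}, {}\<rangle>"
| t_int: "{A, B} \<turnstile> Interact A B m : \<langle>{Out A B m, Inp A B m}, {Out A B m, Inp A B m}\<rangle>"
| t_seq: "P1 \<turnstile> G1 : \<langle>\<phi>1, \<Lambda>1\<rangle> \<Longrightarrow> P2 \<turnstile> G2 : \<langle>\<phi>2, \<Lambda>2\<rangle> \<Longrightarrow>
    P1 \<union> P2 \<turnstile> Seq G1 G2 : \<langle>\<phi>1 \<union> remove_sbj \<phi>2 P1, \<Lambda>2 \<union> remove_sbj \<Lambda>1 P2\<rangle>"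
| t_par: "P1 \<turnstile> G1 : \<langle>\<phi>1, \<Lambda>1\<rangle> \<Longrightarrow> P2 \<turnstile> G2 : \<langle>\<phi>2, \<Lambda>2\<rangle> \<Longrightarrow> P1 \<inter> P2 = {} \<Longrightarrow>
    P1 \<union> P2 \<turnstile> Par G1 G2 : \<langle>\<phi>1 \<union> \<phi>2, \<Lambda>1 \<union> \<Lambda>2\<rangle>"
| t_ch: "P \<turnstile> G1 : \<langle>\<phi>1, \<Lambda>1\<rangle> \<Longrightarrow> P \<turnstile> G2 : \<langle>\<phi>2, \<Lambda>2\<rangle> \<Longrightarrow> ch_cond P \<phi>1 \<phi>2 \<Longrightarrow>
    P \<turnstile> Choice G1 G2 : \<langle>\<phi>1 \<union> \<phi>2, \<Lambda>1 \<union> \<Lambda>2\<rangle>"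

end

theory Submission
  imports Defs
begin

text \<open>
  The typing judgement is sound because every maximal configuration of the semantics of a typed
  choreography contains, for each participant in \<open>P\<close>, an event of that participant. Hence in
  \<open>Seq G H\<close> no event of a copy of \<open>H\<close> whose subject occurs in \<open>G\<close> is minimal in its projection.
  Dually, every event of \<open>G\<close> lies in some maximal configuration, so it is dominated by an event
  of the corresponding copy of \<open>H\<close> as soon as its subject occurs in \<open>H\<close>.
\<close>

section \<open>Configurations and maximal configurations of finite event structures\<close>

lemma MaxC_events: "x \<in> MaxC E \<Longrightarrow> a \<in> x \<Longrightarrow> a \<in> events E"
  by (auto simp: MaxC_def configuration_def)

lemma MaxC_conflict_free: "x \<in> MaxC E \<Longrightarrow> a \<in> x \<Longrightarrow> b \<in> x \<Longrightarrow> (a, b) \<notin> conflict E"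
  by (auto simp: MaxC_def configuration_def)

text \<open>Pulls a configuration of a composite structure back along one of the tags
  \<open>EvL\<close>, \<open>EvR\<close> or \<open>EvCopy x\<close>. Preservation of conflict and
  order suffices, because a configuration is defined by the absence of conflicts and by closure
  under predecessors.\<close>

lemma configuration_vimage:
  assumes y: "configuration E y"
    and events: "\<And>a. f a \<in> events E \<longleftrightarrow> a \<in> events F"
    and conflict: "\<And>a b. (a, b) \<in> conflict F \<Longrightarrow> (f a, f b) \<in> conflict E"
    and le: "\<And>a b. (a, b) \<in> le F \<Longrightarrow> (f a, f b) \<in> le E"
  shows "configuration F (f -` y)"
  unfolding configuration_def
proof (intro conjI ballI impI)
  show "f -` y \<subseteq> events F" using y events by (auto simp: configuration_def)
next
  fix a b assume "a \<in> f -` y" "b \<in> f -` y"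
  then show "(a, b) \<notin> conflict F" using y conflict unfolding configuration_def by blast
next
  fix a b assume "a \<in> f -` y" "b \<in> events F" "(b, a) \<in> le F"
  then show "b \<in> f -` y" using y le events unfolding configuration_def by blast
qed

text \<open>The record type enforces none of the axioms, so they are collected here. Finiteness is
  added so that configurations extend to maximal ones and maximal ones can index copies.\<close>

locale event_structure =
  fixes E :: "('e, 'p, 'm) les"
  assumes finite_events: "finite (events E)"
    and le_events: "(a, b) \<in> le E \<Longrightarrow> a \<in> events E \<and> b \<in> events E"
    and le_refl: "a \<in> events E \<Longrightarrow> (a, a) \<in> le E"
    and le_antisym: "(a, b) \<in> le E \<Longrightarrow> (b, a) \<in> le E \<Longrightarrow> a = b"
    and le_trans: "(a, b) \<in> le E \<Longrightarrow> (b, c) \<in> le E \<Longrightarrow> (a, c) \<in> le E"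
    and conflict_irrefl: "(a, a) \<notin> conflict E"
    and conflict_sym: "(a, b) \<in> conflict E \<Longrightarrow> (b, a) \<in> conflict E"
    and conflict_hereditary: "(a, b) \<in> conflict E \<Longrightarrow> (b, c) \<in> le E \<Longrightarrow> (a, c) \<in> conflict E"
begin

lemma configuration_extends_to_MaxC:
  assumes "configuration E x"
  obtains y where "y \<in> MaxC E" "x \<subseteq> y"
proof -
  have "finite {y. configuration E y}"
    by (rule finite_subset[of _ "Pow (events E)"])
      (auto simp: configuration_def finite_events)
  then obtain y where "configuration E y" "x \<subseteq> y"
      "\<forall>z\<in>{y. configuration E y}. y \<subseteq> z \<longrightarrow> y = z"
    using finite_has_maximal2[of "{y. configuration E y}" x] assms by auto
  then show thesis
    by (intro that[of y]) (auto simp: MaxC_def)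
qed

text \<open>Two conflicting events below \<open>e\<close> would, by heredity applied on both sides,
  put \<open>e\<close> in conflict with itself.\<close>

lemma down_closure_configuration:
  assumes "e \<in> events E"
  shows "configuration E {a. (a, e) \<in> le E}"
proof -
  have "(a, b) \<notin> conflict E" if "(a, e) \<in> le E" "(b, e) \<in> le E" for a b
    using that conflict_hereditary conflict_sym conflict_irrefl by meson
  then show ?thesis
    unfolding configuration_def using le_events le_trans by blast
qed

lemma event_in_MaxC:
  assumes "e \<in> events E"
  obtains x where "x \<in> MaxC E" "e \<in> x"
  using configuration_extends_to_MaxC[OF down_closure_configuration[OF assms]] le_refl[OF assms]
  by blast

lemma MaxC_nonempty: obtains x where "x \<in> MaxC E"
  using configuration_extends_to_MaxC[of "{}"] by (auto simp: configuration_def)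

lemma MaxC_down_closed: "x \<in> MaxC E \<Longrightarrow> b \<in> x \<Longrightarrow> (a, b) \<in> le E \<Longrightarrow> a \<in> x"
  using le_events by (auto simp: MaxC_def configuration_def)

lemma MaxC_finite: "x \<in> MaxC E \<Longrightarrow> finite x"
  using finite_events finite_subset by (auto simp: MaxC_def configuration_def)

end

text \<open>The events behind \<open>min_labels (proj E A)\<close>, described inside
  \<open>E\<close> itself so that later arguments never handle the restricted record.\<close>

definition min_events :: "('e, 'p, 'm) les \<Rightarrow> 'p \<Rightarrow> 'e set" where
  "min_events E A = {e \<in> events E. sbj (lab E e) = A \<and>
     (\<forall>e'\<in>events E. sbj (lab E e') = A \<longrightarrow> (e', e) \<in> le E \<longrightarrow> e' = e)}"

definition max_events :: "('e, 'p, 'm) les \<Rightarrow> 'p \<Rightarrow> 'e set" where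
  "max_events E A = {e \<in> events E. sbj (lab E e) = A \<and>
     (\<forall>e'\<in>events E. sbj (lab E e') = A \<longrightarrow> (e, e') \<in> le E \<longrightarrow> e' = e)}"

lemma min_labels_proj: "min_labels (proj E A) = lab E ` min_events E A"
  by (auto simp: min_labels_def min_events_def proj_def Let_def intro!: image_eqI)

lemma max_labels_proj: "max_labels (proj E A) = lab E ` max_events E A"
  by (auto simp: max_labels_def max_events_def proj_def Let_def intro!: image_eqI)


section \<open>Parallel composition and choice\<close>

lemma par_es_sel [simp]:
  "events (par_es E1 E2) = EvL ` events E1 \<union> EvR ` events E2"
  "le (par_es E1 E2) = map_prod EvL EvL ` le E1 \<union> map_prod EvR EvR ` le E2"
  "conflict (par_es E1 E2) = map_prod EvL EvL ` conflict E1 \<union> map_prod EvR EvR ` conflict E2"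
  "lab (par_es E1 E2) = join_lab (lab E1) (lab E2)"
  by (simp_all add: par_es_def)

lemma choice_es_sel [simp]:
  "events (choice_es E1 E2) = EvL ` events E1 \<union> EvR ` events E2"
  "le (choice_es E1 E2) = map_prod EvL EvL ` le E1 \<union> map_prod EvR EvR ` le E2"
  "conflict (choice_es E1 E2) = map_prod EvL EvL ` conflict E1 \<union> map_prod EvR EvR ` conflict E2
     \<union> (EvL ` events E1) \<times> (EvR ` events E2) \<union> (EvR ` events E2) \<times> (EvL ` events E1)"
  "lab (choice_es E1 E2) = join_lab (lab E1) (lab E2)"
  by (simp_all add: choice_es_def)

lemma map_prod_image_iffs [simp]:
  "(EvL a, EvL b) \<in> map_prod EvL EvL ` R \<longleftrightarrow> (a, b) \<in> R"
  "(EvR a, EvR b) \<in> map_prod EvR EvR ` R \<longleftrightarrow> (a, b) \<in> R"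
  "(EvR a, q) \<notin> map_prod EvL EvL ` R" "(p, EvR b) \<notin> map_prod EvL EvL ` R"
  "(EvL a, q) \<notin> map_prod EvR EvR ` R" "(p, EvL b) \<notin> map_prod EvR EvR ` R"
  by auto

text \<open>Stated for any \<open>E\<close> with the events, order and labels of a disjoint union:
  \<open>par_es\<close> and \<open>choice_es\<close> differ only in their conflicts, which
  minimality ignores.\<close>

lemma min_labels_proj_sum:
  assumes "events E = EvL ` events E1 \<union> EvR ` events E2"
    and "le E = map_prod EvL EvL ` le E1 \<union> map_prod EvR EvR ` le E2"
    and "lab E = join_lab (lab E1) (lab E2)"
  shows "min_labels (proj E A) = min_labels (proj E1 A) \<union> min_labels (proj E2 A)"
proof -
  have "min_events E A = EvL ` min_events E1 A \<union> EvR ` min_events E2 A"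
    unfolding min_events_def assms by (rule set_eqI) (auto simp: ball_Un)
  then show ?thesis
    by (simp add: min_labels_proj max_labels_proj assms(3) image_Un image_image)
qed

lemma max_labels_proj_sum:
  assumes "events E = EvL ` events E1 \<union> EvR ` events E2"
    and "le E = map_prod EvL EvL ` le E1 \<union> map_prod EvR EvR ` le E2"
    and "lab E = join_lab (lab E1) (lab E2)"
  shows "max_labels (proj E A) = max_labels (proj E1 A) \<union> max_labels (proj E2 A)"
proof -
  have "max_events E A = EvL ` max_events E1 A \<union> EvR ` max_events E2 A"
    unfolding max_events_def assms by (rule set_eqI) (auto simp: ball_Un)
  then show ?thesis
    by (simp add: min_labels_proj max_labels_proj assms(3) image_Un image_image)
qed

lemma event_structure_par:
  assumes "event_structure E1" "event_structure E2"
  shows "event_structure (par_es E1 E2)"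
proof -
  interpret E1: event_structure E1 by fact
  interpret E2: event_structure E2 by fact
  show ?thesis
    by unfold_locales
      (auto simp: E1.finite_events E2.finite_events E1.conflict_irrefl E2.conflict_irrefl
        E1.le_refl E2.le_refl E1.conflict_sym E2.conflict_sym
        dest: E1.le_events E2.le_events E1.le_antisym E2.le_antisym E1.le_trans E2.le_trans
          E1.conflict_hereditary E2.conflict_hereditary)
qed

lemma event_structure_choice:
  assumes "event_structure E1" "event_structure E2"
  shows "event_structure (choice_es E1 E2)"
proof -
  interpret E1: event_structure E1 by fact
  interpret E2: event_structure E2 by fact
  show ?thesis
    by unfold_locales
      (auto simp: E1.finite_events E2.finite_events E1.conflict_irrefl E2.conflict_irrefl
        E1.le_refl E2.le_refl E1.conflict_sym E2.conflict_sym
        dest: E1.le_events E2.le_events E1.le_antisym E2.le_antisym E1.le_trans E2.le_trans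
          E1.conflict_hereditary E2.conflict_hereditary)
qed

text \<open>There is no conflict across the two sides, so either half of \<open>y\<close> can be
  enlarged while the other is kept. Maximality of \<open>y\<close> therefore passes to both
  halves.\<close>

lemma MaxC_par:
  assumes y: "y \<in> MaxC (par_es E1 E2)"
  shows "EvL -` y \<in> MaxC E1" "EvR -` y \<in> MaxC E2"
proof -
  have conf: "configuration (par_es E1 E2) y"
    and max: "\<And>z. configuration (par_es E1 E2) z \<Longrightarrow> y \<subseteq> z \<Longrightarrow> z = y"
    using y by (simp_all add: MaxC_def)
  have L: "configuration E1 (EvL -` y)" and R: "configuration E2 (EvR -` y)"
    by (rule configuration_vimage[OF conf]; auto)+
  have join: "configuration (par_es E1 E2) (EvL ` u \<union> EvR ` v)"
    if "configuration E1 u" "configuration E2 v" for u v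
    using that unfolding configuration_def by (simp add: ball_Un) blast
  have y_sub: "y \<subseteq> EvL ` events E1 \<union> EvR ` events E2"
    using conf by (simp add: configuration_def)
  have maxL: "u = EvL -` y" if "configuration E1 u" "EvL -` y \<subseteq> u" for u
  proof -
    have "EvL ` u \<union> EvR ` (EvR -` y) = y"
      by (rule max[OF join[OF that(1) R]]) (use y_sub that(2) in blast)
    then show ?thesis by blast
  qed
  have maxR: "v = EvR -` y" if "configuration E2 v" "EvR -` y \<subseteq> v" for v
  proof -
    have "EvL ` (EvL -` y) \<union> EvR ` v = y"
      by (rule max[OF join[OF L that(1)]]) (use y_sub that(2) in blast)
    then show ?thesis by blast
  qed
  show "EvL -` y \<in> MaxC E1" "EvR -` y \<in> MaxC E2"
    using L R maxL maxR by (simp_all add: MaxC_def)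
qed

text \<open>Events of opposite sides always conflict, so \<open>y\<close> lies within one side.
  Configurations of that side are configurations of the whole, hence \<open>y\<close> is maximal
  there too.\<close>

lemma MaxC_choice:
  assumes y: "y \<in> MaxC (choice_es E1 E2)"
  shows "EvL -` y \<in> MaxC E1 \<or> EvR -` y \<in> MaxC E2"
proof -
  have conf: "configuration (choice_es E1 E2) y"
    and max: "\<And>z. configuration (choice_es E1 E2) z \<Longrightarrow> y \<subseteq> z \<Longrightarrow> z = y"
    using y by (simp_all add: MaxC_def)
  have L: "configuration E1 (EvL -` y)" and R: "configuration E2 (EvR -` y)"
    by (rule configuration_vimage[OF conf]; auto)+
  have inL: "configuration (choice_es E1 E2) (EvL ` u)" if "configuration E1 u" for u
    using that unfolding configuration_def by (simp add: ball_Un) blast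
  have inR: "configuration (choice_es E1 E2) (EvR ` v)" if "configuration E2 v" for v
    using that unfolding configuration_def by (simp add: ball_Un) blast
  have "y \<subseteq> EvL ` events E1 \<union> EvR ` events E2"
    using conf by (simp add: configuration_def)
  moreover have "\<not> (EvL a \<in> y \<and> EvR b \<in> y)" if "a \<in> events E1" "b \<in> events E2" for a b
    using conf that unfolding configuration_def by fastforce
  ultimately consider "y \<subseteq> EvL ` events E1" | "y \<subseteq> EvR ` events E2"
    by blast
  then show ?thesis
  proof cases
    case 1
    have "u = EvL -` y" if "configuration E1 u" "EvL -` y \<subseteq> u" for u
    proof -
      have "EvL ` u = y"
        by (rule max[OF inL[OF that(1)]]) (use 1 that(2) in blast)
      then show ?thesis by blast
    qed
    then show ?thesis using L by (simp add: MaxC_def)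
  next
    case 2
    have "v = EvR -` y" if "configuration E2 v" "EvR -` y \<subseteq> v" for v
    proof -
      have "EvR ` v = y"
        by (rule max[OF inR[OF that(1)]]) (use 2 that(2) in blast)
      then show ?thesis by blast
    qed
    then show ?thesis using R by (simp add: MaxC_def)
  qed
qed


section \<open>Sequential composition\<close>

lemma seq_es_sel [simp]:
  "events (seq_es E1 E2) = seq_events E1 E2"
  "le (seq_es E1 E2) = seq_le E1 E2"
  "conflict (seq_es E1 E2) = seq_conflict E1 E2"
  "lab (seq_es E1 E2) = join_lab (lab E1) (lab E2)"
  by (simp_all add: seq_es_def)

locale seq_structures =
  E1: event_structure E1 + E2: event_structure E2
  for E1 E2 :: "('p, 'm) es"
begin

section \<open>Order and conflict of the sequential composition\<close>

lemma seq_le_L: "(a, b) \<in> le E1 \<Longrightarrow> (EvL a, EvL b) \<in> seq_le E1 E2"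
  unfolding seq_le_def gen_order_def by (rule r_into_trancl) force

lemma seq_le_Copy:
  "fset x \<in> MaxC E1 \<Longrightarrow> (a, b) \<in> le E2 \<Longrightarrow> (EvCopy x a, EvCopy x b) \<in> seq_le E1 E2"
  unfolding seq_le_def gen_order_def by (rule r_into_trancl) force

lemma seq_le_L_Copy:
  "fset x \<in> MaxC E1 \<Longrightarrow> a \<in> fset x \<Longrightarrow> b \<in> events E2 \<Longrightarrow> sbj (lab E1 a) = sbj (lab E2 b) \<Longrightarrow>
    (EvL a, EvCopy x b) \<in> seq_le E1 E2"
  unfolding seq_le_def gen_order_def by (rule r_into_trancl) force

text \<open>
  Only an inclusion: an event of \<open>x\<close> need not be below every event of the copy for \<open>x\<close>.
\<close>

lemma seq_le_cases:
  assumes "(p, q) \<in> seq_le E1 E2"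
  obtains (L) a b where "p = EvL a" "q = EvL b" "(a, b) \<in> le E1"
  | (Copy) x a b where "p = EvCopy x a" "q = EvCopy x b" "fset x \<in> MaxC E1" "(a, b) \<in> le E2"
  | (L_Copy) x a b where "p = EvL a" "q = EvCopy x b" "fset x \<in> MaxC E1" "a \<in> fset x"
      "b \<in> events E2"
proof -
  \<comment> \<open>\<open>S\<close> drops the equal-subject condition from the generators, which
    makes it transitive: a step in \<open>E1\<close> may change the subject before the jump into the
    copy. Prepending such a step stays in \<open>S\<close> because \<open>fset x\<close> is downward
    closed.\<close>
  define S where "S = map_prod EvL EvL ` le E1
    \<union> {(EvCopy x a, EvCopy x b) | x a b. fset x \<in> MaxC E1 \<and> (a, b) \<in> le E2}
    \<union> {(EvL a, EvCopy x b) | x a b. fset x \<in> MaxC E1 \<and> a \<in> fset x \<and> b \<in> events E2}"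
  have "trans S"
    unfolding S_def
    by (rule transI) (auto dest: E1.le_trans E2.le_trans E2.le_events E1.MaxC_down_closed)
  then have "S\<^sup>+ = S" by (rule trancl_id)
  moreover have "seq_le E1 E2 \<subseteq> S\<^sup>+"
    unfolding seq_le_def gen_order_def
  proof (intro trancl_mono_subset Un_least)
    show "Id_on (seq_events E1 E2) \<subseteq> S"
      using E1.le_refl E2.le_refl by (fastforce simp: S_def seq_events_def)
  qed (auto simp: S_def)
  ultimately have "(p, q) \<in> S" using assms by blast
  then have "(\<exists>a b. p = EvL a \<and> q = EvL b \<and> (a, b) \<in> le E1)
      \<or> (\<exists>x a b. p = EvCopy x a \<and> q = EvCopy x b \<and> fset x \<in> MaxC E1 \<and> (a, b) \<in> le E2)
      \<or> (\<exists>x a b. p = EvL a \<and> q = EvCopy x b \<and> fset x \<in> MaxC E1 \<and> a \<in> fset x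
          \<and> b \<in> events E2)"
    unfolding S_def by auto
  then show thesis using that by blast
qed

text \<open>The five families contain the generators and are already closed under symmetry and
  heredity, so heredity creates no new kind of conflict.\<close>

lemma seq_conflict_cases:
  assumes "(p, q) \<in> seq_conflict E1 E2"
  obtains (L) a b where "p = EvL a" "q = EvL b" "(a, b) \<in> conflict E1"
  | (L_Copy) a x b where "p = EvL a" "q = EvCopy x b" "fset x \<in> MaxC E1" "a \<notin> fset x"
  | (Copy_L) x a b where "p = EvCopy x a" "q = EvL b" "fset x \<in> MaxC E1" "b \<notin> fset x"
  | (Copy) x a b where "p = EvCopy x a" "q = EvCopy x b" "fset x \<in> MaxC E1" "(a, b) \<in> conflict E2"
  | (Copies) x y a b where "p = EvCopy x a" "q = EvCopy y b" "fset x \<in> MaxC E1" "fset y \<in> MaxC E1"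
      "x \<noteq> y"
proof -
  have "(\<exists>a b. p = EvL a \<and> q = EvL b \<and> (a, b) \<in> conflict E1)
      \<or> (\<exists>a x b. p = EvL a \<and> q = EvCopy x b \<and> fset x \<in> MaxC E1 \<and> a \<notin> fset x)
      \<or> (\<exists>x a b. p = EvCopy x a \<and> q = EvL b \<and> fset x \<in> MaxC E1 \<and> b \<notin> fset x)
      \<or> (\<exists>x a b. p = EvCopy x a \<and> q = EvCopy x b \<and> fset x \<in> MaxC E1 \<and> (a, b) \<in> conflict E2)
      \<or> (\<exists>x y a b. p = EvCopy x a \<and> q = EvCopy y b \<and> fset x \<in> MaxC E1 \<and> fset y \<in> MaxC E1
          \<and> x \<noteq> y)"
    using assms unfolding seq_conflict_def
  proof (induction rule: gen_conflict.induct)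
    case (base p q)
    then show ?case by auto
  next
    case (sym p q)
    then show ?case by (auto intro: E1.conflict_sym E2.conflict_sym)
  next
    case (hereditary p q r)
    from hereditary(2) show ?case
    proof (cases rule: seq_le_cases)
      case (L a b)
      then show ?thesis
        using hereditary(3) by (auto dest: E1.MaxC_down_closed E1.conflict_hereditary)
    next
      case (Copy x a b)
      then show ?thesis
        using hereditary(3) by (auto dest: E2.conflict_hereditary)
    next
      \<comment> \<open>Here \<open>a\<close> lies in \<open>fset x\<close>. An event of
        \<open>E1\<close> in conflict with \<open>a\<close> is outside \<open>fset x\<close>, as
        \<open>fset x\<close> is conflict-free; a copy in conflict with \<open>a\<close> belongs to
        another configuration.\<close>
      case (L_Copy x a b)
      then show ?thesis
        using hereditary(3) by (auto dest: MaxC_conflict_free)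
    qed
  qed
  then show thesis
    by (elim disjE exE conjE) (rule that; assumption)+
qed

lemma seq_conflict_L: "(a, b) \<in> conflict E1 \<Longrightarrow> (EvL a, EvL b) \<in> seq_conflict E1 E2"
  unfolding seq_conflict_def by (rule gen_conflict.base) force

lemma seq_conflict_Copy:
  "fset x \<in> MaxC E1 \<Longrightarrow> (a, b) \<in> conflict E2 \<Longrightarrow>
    (EvCopy x a, EvCopy x b) \<in> seq_conflict E1 E2"
  unfolding seq_conflict_def by (rule gen_conflict.base) force

lemma seq_conflict_Copies:
  "fset x \<in> MaxC E1 \<Longrightarrow> fset y \<in> MaxC E1 \<Longrightarrow> x \<noteq> y \<Longrightarrow> a \<in> events E2 \<Longrightarrow> b \<in> events E2 \<Longrightarrow>
    (EvCopy x a, EvCopy y b) \<in> seq_conflict E1 E2"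
  unfolding seq_conflict_def by (rule gen_conflict.base) force

lemma seq_conflict_L_Copy:
  "fset x \<in> MaxC E1 \<Longrightarrow> a \<in> events E1 - fset x \<Longrightarrow> b \<in> events E2 \<Longrightarrow>
    (EvL a, EvCopy x b) \<in> seq_conflict E1 E2"
  unfolding seq_conflict_def by (rule gen_conflict.base) force

lemma finite_seq_events: "finite (seq_events E1 E2)"
proof -
  have "fset ` {x. fset x \<in> MaxC E1} \<subseteq> Pow (events E1)"
    by (auto simp: MaxC_def configuration_def)
  then have "finite (fset ` {x. fset x \<in> MaxC E1})"
    using E1.finite_events finite_subset by blast
  then have "finite {x. fset x \<in> MaxC E1}"
    by (rule finite_imageD) (auto simp: inj_on_def fset_inject)
  then show ?thesis
    unfolding seq_events_def using E1.finite_events E2.finite_events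
    by (auto intro: finite_image_set2)
qed

text \<open>Reflexivity, transitivity, symmetry and heredity are built into the generated relations.
  Antisymmetry and irreflexivity are read off the two case lists.\<close>

lemma event_structure_seq: "event_structure (seq_es E1 E2)"
proof
  show "finite (events (seq_es E1 E2))"
    by (simp add: finite_seq_events)
next
  fix a b assume "(a, b) \<in> le (seq_es E1 E2)"
  then show "a \<in> events (seq_es E1 E2) \<and> b \<in> events (seq_es E1 E2)"
    by (auto simp: seq_events_def elim!: seq_le_cases dest: E1.le_events E2.le_events MaxC_events)
next
  fix a assume "a \<in> events (seq_es E1 E2)"
  then show "(a, a) \<in> le (seq_es E1 E2)"
    by (auto simp: seq_le_def gen_order_def)
next
  fix a b assume "(a, b) \<in> le (seq_es E1 E2)" "(b, a) \<in> le (seq_es E1 E2)"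
  then show "a = b"
    by (auto elim!: seq_le_cases intro: E1.le_antisym E2.le_antisym)
next
  fix a b c assume "(a, b) \<in> le (seq_es E1 E2)" "(b, c) \<in> le (seq_es E1 E2)"
  then show "(a, c) \<in> le (seq_es E1 E2)"
    by (auto simp: seq_le_def gen_order_def)
next
  fix a show "(a, a) \<notin> conflict (seq_es E1 E2)"
    by (auto elim!: seq_conflict_cases simp: E1.conflict_irrefl E2.conflict_irrefl)
next
  fix a b assume "(a, b) \<in> conflict (seq_es E1 E2)"
  then show "(b, a) \<in> conflict (seq_es E1 E2)"
    by (auto simp: seq_conflict_def intro: gen_conflict.sym)
next
  fix a b c assume "(a, b) \<in> conflict (seq_es E1 E2)" "(b, c) \<in> le (seq_es E1 E2)"
  then show "(a, c) \<in> conflict (seq_es E1 E2)"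
    by (auto simp: seq_conflict_def intro: gen_conflict.hereditary)
qed

section \<open>Configurations of the sequential composition\<close>

lemma configuration_seqI:
  assumes x: "fset x \<in> MaxC E1" and z: "configuration E2 z"
  shows "configuration (seq_es E1 E2) (EvL ` fset x \<union> EvCopy x ` z)"
  unfolding configuration_def seq_es_sel
proof (intro conjI ballI impI)
  show "EvL ` fset x \<union> EvCopy x ` z \<subseteq> seq_events E1 E2"
    using x z by (auto simp: seq_events_def configuration_def dest: MaxC_events)
next
  fix p q assume "p \<in> EvL ` fset x \<union> EvCopy x ` z" "q \<in> EvL ` fset x \<union> EvCopy x ` z"
  then show "(p, q) \<notin> seq_conflict E1 E2"
    using x z by (auto simp: configuration_def elim!: seq_conflict_cases dest: MaxC_conflict_free)
next
  \<comment> \<open>Predecessors of copy events lie in the same copy or in \<open>fset x\<close>;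
    those of \<open>E1\<close> events stay in \<open>E1\<close>. Both \<open>z\<close> and
    \<open>fset x\<close> are downward closed.\<close>
  fix p q
  assume "p \<in> EvL ` fset x \<union> EvCopy x ` z" "(q, p) \<in> seq_le E1 E2"
  moreover have "a \<in> z" if "b \<in> z" "(a, b) \<in> le E2" for a b
    using z that E2.le_events by (auto simp: configuration_def)
  ultimately show "q \<in> EvL ` fset x \<union> EvCopy x ` z"
    using x by (auto elim!: seq_le_cases dest: E1.MaxC_down_closed)
qed

text \<open>An event of the copy for \<open>x\<close> conflicts with all other copies and with every
  event of \<open>E1\<close> outside \<open>fset x\<close>, so it determines \<open>x\<close>. If
  \<open>y\<close> has no copy event, any maximal extension of its \<open>E1\<close> part serves,
  with \<open>z\<close> empty. Only an inclusion holds, since a copy event need not have all of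
  \<open>fset x\<close> below it.\<close>

lemma configuration_seqE:
  assumes y: "configuration (seq_es E1 E2) y"
  obtains x z where "fset x \<in> MaxC E1" "configuration E2 z" "y \<subseteq> EvL ` fset x \<union> EvCopy x ` z"
proof (cases "\<exists>x a. EvCopy x a \<in> y")
  case True
  then obtain x a where xa: "EvCopy x a \<in> y" by blast
  have ev: "y \<subseteq> seq_events E1 E2" using y by (simp add: configuration_def)
  have free: "\<And>p q. p \<in> y \<Longrightarrow> q \<in> y \<Longrightarrow> (p, q) \<notin> seq_conflict E1 E2"
    using y by (simp add: configuration_def)
  have x: "fset x \<in> MaxC E1" and a: "a \<in> events E2"
    using xa ev by (auto simp: seq_events_def)
  have "configuration E2 (EvCopy x -` y)"
    by (rule configuration_vimage[OF y])
      (auto simp: seq_events_def x seq_conflict_Copy seq_le_Copy)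
  moreover have "y \<subseteq> EvL ` fset x \<union> EvCopy x ` (EvCopy x -` y)"
  proof
    fix p assume p: "p \<in> y"
    then consider (L) c where "p = EvL c" "c \<in> events E1"
      | (Copy) w c where "p = EvCopy w c" "fset w \<in> MaxC E1" "c \<in> events E2"
      using ev by (auto simp: seq_events_def)
    then show "p \<in> EvL ` fset x \<union> EvCopy x ` (EvCopy x -` y)"
    proof cases
      case L
      then show ?thesis using free[OF p xa] seq_conflict_L_Copy[OF x _ a] by blast
    next
      case Copy
      then show ?thesis using free[OF p xa] seq_conflict_Copies[OF _ x _ _ a] p by blast
    qed
  qed
  ultimately show thesis using that x by blast
next
  case False
  have ev: "y \<subseteq> EvL ` events E1" using y False by (auto simp: configuration_def seq_events_def)
  have "configuration E1 (EvL -` y)"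
    by (rule configuration_vimage[OF y])
      (auto simp: seq_events_def seq_conflict_L seq_le_L)
  then obtain u where u: "u \<in> MaxC E1" "EvL -` y \<subseteq> u"
    by (rule E1.configuration_extends_to_MaxC)
  \<comment> \<open>Copies are indexed by values of type \<open>ev fset\<close>; finiteness of
    \<open>u\<close> provides such an index.\<close>
  then obtain x where "fset x = u"
    using E1.MaxC_finite by (metis fset_of_list.rep_eq finite_list)
  moreover have "y \<subseteq> EvL ` u"
    using ev u(2) by blast
  ultimately show thesis
    using u(1) by (intro that[of x "{}"]) (auto simp: configuration_def)
qed

text \<open>Maximality turns the inclusion of \<open>configuration_seqE\<close> into an equality.
  Then \<open>z\<close> is maximal, because enlarging it within the same copy would enlarge
  \<open>y\<close>.\<close>

lemma MaxC_seqE: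
  assumes "y \<in> MaxC (seq_es E1 E2)"
  obtains x z where "fset x \<in> MaxC E1" "z \<in> MaxC E2" "y = EvL ` fset x \<union> EvCopy x ` z"
proof -
  have conf: "configuration (seq_es E1 E2) y"
    and max: "\<And>z. configuration (seq_es E1 E2) z \<Longrightarrow> y \<subseteq> z \<Longrightarrow> z = y"
    using assms by (auto simp: MaxC_def)
  obtain x z where x: "fset x \<in> MaxC E1" and z: "configuration E2 z"
      and "y \<subseteq> EvL ` fset x \<union> EvCopy x ` z"
    using configuration_seqE[OF conf] .
  then have y: "y = EvL ` fset x \<union> EvCopy x ` z"
    using max[OF configuration_seqI[OF x z]] by simp
  have vimage: "EvCopy x -` (EvL ` fset x \<union> EvCopy x ` u) = u" for u
    by auto
  have "w = z" if "configuration E2 w" "z \<subseteq> w" for w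
  proof -
    have "EvL ` fset x \<union> EvCopy x ` w = y"
      by (rule max[OF configuration_seqI[OF x that(1)]]) (use that(2) y in auto)
    then show ?thesis using vimage y by metis
  qed
  then have "z \<in> MaxC E2" using z by (auto simp: MaxC_def)
  then show thesis using that x y by blast
qed

section \<open>Minimal and maximal labels of projected sequential compositions\<close>

lemma seq_le_iffs:
  "(EvL a, EvL b) \<in> seq_le E1 E2 \<longleftrightarrow> (a, b) \<in> le E1"
  "(EvCopy x a, EvCopy y b) \<in> seq_le E1 E2 \<longleftrightarrow> x = y \<and> fset x \<in> MaxC E1 \<and> (a, b) \<in> le E2"
  "(EvCopy x a, EvL b) \<notin> seq_le E1 E2"
  by (auto elim: seq_le_cases intro: seq_le_L seq_le_Copy)

text \<open>For equal subjects the over-approximation in \<open>seq_le_cases\<close> is exact. A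
  projection compares only such pairs.\<close>

lemma seq_le_L_Copy_iff:
  assumes "sbj (lab E1 a) = sbj (lab E2 b)" "b \<in> events E2"
  shows "(EvL a, EvCopy x b) \<in> seq_le E1 E2 \<longleftrightarrow> fset x \<in> MaxC E1 \<and> a \<in> fset x"
  using assms by (auto elim: seq_le_cases intro: seq_le_L_Copy)

lemma seq_events_iffs:
  "EvL a \<in> seq_events E1 E2 \<longleftrightarrow> a \<in> events E1"
  "EvCopy x b \<in> seq_events E1 E2 \<longleftrightarrow> fset x \<in> MaxC E1 \<and> b \<in> events E2"
  by (auto simp: seq_events_def)

lemma ball_seq_events:
  "(\<forall>p\<in>seq_events E1 E2. Q p) \<longleftrightarrow>
    (\<forall>a\<in>events E1. Q (EvL a)) \<and> (\<forall>x. fset x \<in> MaxC E1 \<longrightarrow> (\<forall>b\<in>events E2. Q (EvCopy x b)))"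
  by (auto simp: seq_events_def)

text \<open>The label of \<open>EvCopy x b\<close> does not depend on \<open>x\<close>, so all
  copies collapse into one image under \<open>lab E2\<close>. The inclusion excludes events built by
  the other constructors.\<close>

lemma join_lab_image:
  assumes "M \<subseteq> seq_events E1 E2"
  shows "join_lab (lab E1) (lab E2) ` M
    = lab E1 ` {a. EvL a \<in> M} \<union> lab E2 ` {b. \<exists>x. EvCopy x b \<in> M}"
proof (intro equalityI subsetI)
  fix l assume "l \<in> join_lab (lab E1) (lab E2) ` M"
  then obtain p where "p \<in> M" "l = join_lab (lab E1) (lab E2) p" by blast
  then show "l \<in> lab E1 ` {a. EvL a \<in> M} \<union> lab E2 ` {b. \<exists>x. EvCopy x b \<in> M}"
    using assms by (cases p) (auto simp: seq_events_def)
next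
  fix l assume "l \<in> lab E1 ` {a. EvL a \<in> M} \<union> lab E2 ` {b. \<exists>x. EvCopy x b \<in> M}"
  then show "l \<in> join_lab (lab E1) (lab E2) ` M"
    by (auto intro: rev_image_eqI)
qed

text \<open>Events of \<open>E1\<close> gain no predecessors. An event of subject \<open>A\<close>
  in the copy for \<open>x\<close> lies above every \<open>A\<close>-event of \<open>fset x\<close>,
  so it can be minimal only if there is none; a single \<open>x\<close> of this kind already
  contributes all minimal labels of \<open>E2\<close>.\<close>

lemma min_labels_proj_seq:
  "min_labels (proj (seq_es E1 E2) A) = min_labels (proj E1 A) \<union>
     (if \<exists>x\<in>MaxC E1. \<forall>a\<in>x. sbj (lab E1 a) \<noteq> A then min_labels (proj E2 A) else {})"
proof -
  have "EvL a \<in> min_events (seq_es E1 E2) A \<longleftrightarrow> a \<in> min_events E1 A" for a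
    by (simp add: min_events_def seq_events_iffs ball_seq_events seq_le_iffs)
  moreover have "EvCopy x b \<in> min_events (seq_es E1 E2) A \<longleftrightarrow>
      fset x \<in> MaxC E1 \<and> b \<in> min_events E2 A \<and> (\<forall>a\<in>fset x. sbj (lab E1 a) \<noteq> A)" for x b
    unfolding min_events_def
    by (auto simp: seq_events_iffs ball_seq_events seq_le_iffs seq_le_L_Copy_iff
        dest: MaxC_events)
  moreover have "(\<exists>x. fset x \<in> MaxC E1 \<and> (\<forall>a\<in>fset x. sbj (lab E1 a) \<noteq> A)) \<longleftrightarrow>
      (\<exists>x\<in>MaxC E1. \<forall>a\<in>x. sbj (lab E1 a) \<noteq> A)"
    by (metis E1.MaxC_finite fset_of_list.rep_eq finite_list)
  moreover have "min_events (seq_es E1 E2) A \<subseteq> seq_events E1 E2"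
    by (auto simp: min_events_def)
  ultimately show ?thesis
    by (auto simp: min_labels_proj max_labels_proj join_lab_image)
qed

text \<open>Copy events gain no successors. An \<open>A\<close>-event of \<open>E1\<close> belongs
  to some maximal configuration, and so lies below every \<open>A\<close>-event of the corresponding
  copy.\<close>

lemma max_labels_proj_seq:
  "max_labels (proj (seq_es E1 E2) A) = max_labels (proj E2 A) \<union>
     (if \<exists>b\<in>events E2. sbj (lab E2 b) = A then {} else max_labels (proj E1 A))"
proof -
  have fset: "\<exists>x. fset x = u" if "u \<in> MaxC E1" for u
    using E1.MaxC_finite[OF that] by (metis fset_of_list.rep_eq finite_list)
  have above: "\<exists>x. fset x \<in> MaxC E1 \<and> a \<in> fset x" if "a \<in> events E1" for a
    using E1.event_in_MaxC[OF that] fset by metis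
  have "EvL a \<in> max_events (seq_es E1 E2) A \<longleftrightarrow>
      a \<in> max_events E1 A \<and> (\<forall>b\<in>events E2. sbj (lab E2 b) \<noteq> A)" for a
    using above[of a] unfolding max_events_def
    by (auto simp: seq_events_iffs ball_seq_events seq_le_iffs seq_le_L_Copy_iff) blast
  moreover have "EvCopy x b \<in> max_events (seq_es E1 E2) A \<longleftrightarrow> fset x \<in> MaxC E1 \<and> b \<in> max_events E2 A"
    for x b
    unfolding max_events_def
    by (auto simp: seq_events_iffs ball_seq_events seq_le_iffs)
  \<comment> \<open>At least one copy of \<open>E2\<close> exists, so the maximal labels of
    \<open>E2\<close> do occur.\<close>
  moreover have "\<exists>x. fset x \<in> MaxC E1"
    using E1.MaxC_nonempty fset by metis
  moreover have "max_events (seq_es E1 E2) A \<subseteq> seq_events E1 E2"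
    by (auto simp: max_events_def)
  ultimately show ?thesis
    by (auto simp: min_labels_proj max_labels_proj join_lab_image)
qed

end


section \<open>Soundness of the typing\<close>

text \<open>The induction invariant. Beyond the label equations it records that subjects stay in
  \<open>P\<close> and that every maximal configuration involves all of \<open>P\<close>. The
  equations range over all participants, as \<open>well_branched\<close> does.\<close>

definition sound_for ::
    "'p set \<Rightarrow> ('p, 'm) label set \<Rightarrow> ('p, 'm) label set \<Rightarrow> ('p, 'm) es \<Rightarrow> bool" where
  "sound_for P \<phi> \<Lambda> E \<longleftrightarrow>
     event_structure E \<and>
     (\<forall>e\<in>events E. sbj (lab E e) \<in> P) \<and>
     (\<forall>x\<in>MaxC E. \<forall>A\<in>P. \<exists>e\<in>x. sbj (lab E e) = A) \<and>
     (\<forall>A. restrict_to \<phi> A = min_labels (proj E A)) \<and>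
     (\<forall>A. restrict_to \<Lambda> A = max_labels (proj E A))"

lemma restrict_to_simps:
  "restrict_to (\<phi> \<union> \<psi>) A = restrict_to \<phi> A \<union> restrict_to \<psi> A"
  "restrict_to (remove_sbj \<phi> P) A = (if A \<in> P then {} else restrict_to \<phi> A)"
  by (auto simp: restrict_to_def remove_sbj_def)

lemma sound_for_outside:
  assumes "sound_for P \<phi> \<Lambda> E" "A \<notin> P"
  shows "min_labels (proj E A) = {}" "max_labels (proj E A) = {}"
  using assms by (fastforce simp: sound_for_def min_labels_proj max_labels_proj
      min_events_def max_events_def)+

text \<open>Some maximal configuration exists, and it contains an event of each participant in
  \<open>P\<close>.\<close>

lemma sound_for_event:
  assumes "sound_for P \<phi> \<Lambda> E" "A \<in> P"
  shows "\<exists>e\<in>events E. sbj (lab E e) = A"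
proof -
  interpret event_structure E using assms by (simp add: sound_for_def)
  obtain x where "x \<in> MaxC E" using MaxC_nonempty .
  then show ?thesis using assms by (meson MaxC_events sound_for_def)
qed

lemma sound_for_empty: "sound_for {} {} {} empty_es"
  by (auto simp: sound_for_def empty_es_def restrict_to_def min_labels_proj max_labels_proj
      min_events_def max_events_def event_structure_def)

text \<open>As \<open>A\<close> and \<open>B\<close> differ, each event is alone in its projection
  and therefore both minimal and maximal there. The set of both events is the only candidate for a
  maximal configuration.\<close>

lemma sound_for_int:
  assumes "A \<noteq> B"
  shows "sound_for {A, B} {Out A B m, Inp A B m} {Out A B m, Inp A B m} (int_es A B m)"
proof -
  have "configuration (int_es A B m) {EvOut, EvInp}"
    by (auto simp: int_es_def configuration_def)
  moreover have "x \<subseteq> {EvOut, EvInp}" if "configuration (int_es A B m) x" for x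
    using that by (simp add: configuration_def int_es_def)
  ultimately have "MaxC (int_es A B m) \<subseteq> {{EvOut, EvInp}}"
    unfolding MaxC_def by blast
  moreover have "\<forall>C\<in>{A, B}. \<exists>e\<in>{EvOut, EvInp}. sbj (lab (int_es A B m) e) = C"
    by (simp add: int_es_def)
  ultimately have "\<forall>x\<in>MaxC (int_es A B m). \<forall>C\<in>{A, B}. \<exists>e\<in>x. sbj (lab (int_es A B m) e) = C"
    by blast
  moreover have "\<forall>e\<in>events (int_es A B m). sbj (lab (int_es A B m) e) \<in> {A, B}"
    by (simp add: int_es_def)
  moreover have "event_structure (int_es A B m)"
    by unfold_locales (auto simp: int_es_def)
  moreover have "restrict_to {Out A B m, Inp A B m} C = min_labels (proj (int_es A B m) C)" for C
    using assms by (auto simp: int_es_def restrict_to_def min_labels_proj min_events_def image_iff)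
  moreover have "restrict_to {Out A B m, Inp A B m} C = max_labels (proj (int_es A B m) C)" for C
    using assms by (auto simp: int_es_def restrict_to_def max_labels_proj max_events_def image_iff)
  ultimately show ?thesis
    by (simp add: sound_for_def)
qed

lemma sound_for_par:
  assumes "sound_for P1 \<phi>1 \<Lambda>1 E1" "sound_for P2 \<phi>2 \<Lambda>2 E2"
  shows "sound_for (P1 \<union> P2) (\<phi>1 \<union> \<phi>2) (\<Lambda>1 \<union> \<Lambda>2) (par_es E1 E2)"
proof -
  have full1: "\<And>x A. x \<in> MaxC E1 \<Longrightarrow> A \<in> P1 \<Longrightarrow> \<exists>e\<in>x. sbj (lab E1 e) = A"
    and full2: "\<And>x A. x \<in> MaxC E2 \<Longrightarrow> A \<in> P2 \<Longrightarrow> \<exists>e\<in>x. sbj (lab E2 e) = A"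
    using assms by (simp_all add: sound_for_def)
  have "\<exists>e\<in>x. sbj (lab (par_es E1 E2) e) = A"
    if "x \<in> MaxC (par_es E1 E2)" "A \<in> P1 \<union> P2" for x A
  proof -
    have "(\<exists>a\<in>EvL -` x. sbj (lab E1 a) = A) \<or> (\<exists>b\<in>EvR -` x. sbj (lab E2 b) = A)"
      using full1[OF MaxC_par(1)[OF that(1)]] full2[OF MaxC_par(2)[OF that(1)]] that(2) by blast
    then show ?thesis
    proof (elim disjE bexE)
      fix a assume "a \<in> EvL -` x" "sbj (lab E1 a) = A"
      then show ?thesis by (intro bexI[of _ "EvL a"]) simp_all
    next
      fix b assume "b \<in> EvR -` x" "sbj (lab E2 b) = A"
      then show ?thesis by (intro bexI[of _ "EvR b"]) simp_all
    qed
  qed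
  moreover have "\<forall>e\<in>events (par_es E1 E2). sbj (lab (par_es E1 E2) e) \<in> P1 \<union> P2"
    using assms by (auto simp: sound_for_def)
  moreover have "event_structure (par_es E1 E2)"
    using assms by (simp add: sound_for_def event_structure_par)
  moreover have "restrict_to (\<phi>1 \<union> \<phi>2) A = min_labels (proj (par_es E1 E2) A)" for A
    using assms
    by (simp add: sound_for_def restrict_to_simps min_labels_proj_sum[OF par_es_sel(1,2,4)])
  moreover have "restrict_to (\<Lambda>1 \<union> \<Lambda>2) A = max_labels (proj (par_es E1 E2) A)" for A
    using assms
    by (simp add: sound_for_def restrict_to_simps max_labels_proj_sum[OF par_es_sel(1,2,4)])
  ultimately show ?thesis
    unfolding sound_for_def by blast
qed

text \<open>A maximal configuration restricts to a maximal one of some branch. Both branches share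
  \<open>P\<close>, so all participants occur whichever branch it is.\<close>

lemma sound_for_choice:
  assumes "sound_for P \<phi>1 \<Lambda>1 E1" "sound_for P \<phi>2 \<Lambda>2 E2"
  shows "sound_for P (\<phi>1 \<union> \<phi>2) (\<Lambda>1 \<union> \<Lambda>2) (choice_es E1 E2)"
proof -
  have full1: "\<And>x A. x \<in> MaxC E1 \<Longrightarrow> A \<in> P \<Longrightarrow> \<exists>e\<in>x. sbj (lab E1 e) = A"
    and full2: "\<And>x A. x \<in> MaxC E2 \<Longrightarrow> A \<in> P \<Longrightarrow> \<exists>e\<in>x. sbj (lab E2 e) = A"
    using assms by (simp_all add: sound_for_def)
  have "\<exists>e\<in>x. sbj (lab (choice_es E1 E2) e) = A"
    if "x \<in> MaxC (choice_es E1 E2)" "A \<in> P" for x A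
  proof -
    have "(\<exists>a\<in>EvL -` x. sbj (lab E1 a) = A) \<or> (\<exists>b\<in>EvR -` x. sbj (lab E2 b) = A)"
      using MaxC_choice[OF that(1)] full1[OF _ that(2)] full2[OF _ that(2)] by blast
    then show ?thesis
    proof (elim disjE bexE)
      fix a assume "a \<in> EvL -` x" "sbj (lab E1 a) = A"
      then show ?thesis by (intro bexI[of _ "EvL a"]) simp_all
    next
      fix b assume "b \<in> EvR -` x" "sbj (lab E2 b) = A"
      then show ?thesis by (intro bexI[of _ "EvR b"]) simp_all
    qed
  qed
  moreover have "\<forall>e\<in>events (choice_es E1 E2). sbj (lab (choice_es E1 E2) e) \<in> P"
    using assms by (auto simp: sound_for_def)
  moreover have "event_structure (choice_es E1 E2)"
    using assms by (simp add: sound_for_def event_structure_choice)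
  moreover have "restrict_to (\<phi>1 \<union> \<phi>2) A = min_labels (proj (choice_es E1 E2) A)" for A
    using assms
    by (simp add: sound_for_def restrict_to_simps min_labels_proj_sum[OF choice_es_sel(1,2,4)])
  moreover have "restrict_to (\<Lambda>1 \<union> \<Lambda>2) A = max_labels (proj (choice_es E1 E2) A)" for A
    using assms
    by (simp add: sound_for_def restrict_to_simps max_labels_proj_sum[OF choice_es_sel(1,2,4)])
  ultimately show ?thesis
    unfolding sound_for_def by blast
qed

lemma sound_for_seq:
  assumes s1: "sound_for P1 \<phi>1 \<Lambda>1 E1" and s2: "sound_for P2 \<phi>2 \<Lambda>2 E2"
  shows "sound_for (P1 \<union> P2) (\<phi>1 \<union> remove_sbj \<phi>2 P1) (\<Lambda>2 \<union> remove_sbj \<Lambda>1 P2) (seq_es E1 E2)"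
proof -
  interpret seq_structures E1 E2
    using assms by (simp add: sound_for_def seq_structures_def)
  have subjects: "\<forall>e\<in>events E1. sbj (lab E1 e) \<in> P1" "\<forall>e\<in>events E2. sbj (lab E2 e) \<in> P2"
    and full: "\<And>x A. x \<in> MaxC E1 \<Longrightarrow> A \<in> P1 \<Longrightarrow> \<exists>e\<in>x. sbj (lab E1 e) = A"
      "\<And>x A. x \<in> MaxC E2 \<Longrightarrow> A \<in> P2 \<Longrightarrow> \<exists>e\<in>x. sbj (lab E2 e) = A"
    and eqs: "\<And>A. restrict_to \<phi>1 A = min_labels (proj E1 A)"
      "\<And>A. restrict_to \<phi>2 A = min_labels (proj E2 A)"
      "\<And>A. restrict_to \<Lambda>1 A = max_labels (proj E1 A)"
      "\<And>A. restrict_to \<Lambda>2 A = max_labels (proj E2 A)"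
    using assms by (auto simp: sound_for_def)
  have "\<exists>e\<in>y. sbj (lab (seq_es E1 E2) e) = A"
    if y: "y \<in> MaxC (seq_es E1 E2)" and A: "A \<in> P1 \<union> P2" for y A
  proof -
    obtain x z where x: "fset x \<in> MaxC E1" and z: "z \<in> MaxC E2"
        and y: "y = EvL ` fset x \<union> EvCopy x ` z"
      using MaxC_seqE[OF y] .
    have "(\<exists>a\<in>fset x. sbj (lab E1 a) = A) \<or> (\<exists>b\<in>z. sbj (lab E2 b) = A)"
      using A full(1)[OF x] full(2)[OF z] by blast
    then show ?thesis using y by (auto simp: bex_Un)
  qed
  moreover have "\<forall>e\<in>seq_events E1 E2. sbj (lab (seq_es E1 E2) e) \<in> P1 \<union> P2"
    using subjects by (auto simp: seq_events_def)
  moreover have "restrict_to (\<phi>1 \<union> remove_sbj \<phi>2 P1) A = min_labels (proj (seq_es E1 E2) A)" for A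
  proof (cases "A \<in> P1")
    case True
    then show ?thesis
      using full(1)[of _ A] by (auto simp: restrict_to_simps eqs min_labels_proj_seq)
  next
    case False
    \<comment> \<open>No event of \<open>E1\<close> has subject \<open>A\<close>, so any maximal
      configuration witnesses the condition in \<open>min_labels_proj_seq\<close>.\<close>
    obtain x where "x \<in> MaxC E1" using E1.MaxC_nonempty .
    then have "\<exists>x\<in>MaxC E1. \<forall>a\<in>x. sbj (lab E1 a) \<noteq> A"
      using False subjects(1) MaxC_events by metis
    then show ?thesis
      using False by (simp add: restrict_to_simps eqs min_labels_proj_seq)
  qed
  moreover have "restrict_to (\<Lambda>2 \<union> remove_sbj \<Lambda>1 P2) A = max_labels (proj (seq_es E1 E2) A)" for A
  proof -
    \<comment> \<open>Matches the test made by \<open>remove_sbj\<close> with the one in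
      \<open>max_labels_proj_seq\<close>.\<close>
    have "A \<in> P2 \<longleftrightarrow> (\<exists>b\<in>events E2. sbj (lab E2 b) = A)"
      using subjects(2) sound_for_event[OF s2] by blast
    then show ?thesis
      by (simp add: restrict_to_simps eqs max_labels_proj_seq)
  qed
  ultimately show ?thesis
    by (simp add: sound_for_def event_structure_seq)
qed

text \<open>A participant outside \<open>P\<close> has no events in either branch, hence is not
  active and is trivially passive. This extends the quantifiers of \<open>ch_cond\<close> from
  \<open>P\<close> to all participants.\<close>

lemma sound_for_well_branched:
  assumes s1: "sound_for P \<phi>1 \<Lambda>1 E1" and s2: "sound_for P \<phi>2 \<Lambda>2 E2" and "ch_cond P \<phi>1 \<phi>2"
  shows "well_branched E1 E2"
proof -
  have act: "active_part E1 E2 A \<longleftrightarrow> ch_active \<phi>1 \<phi>2 A"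
    and pas: "passive_part E1 E2 A \<longleftrightarrow> ch_passive \<phi>1 \<phi>2 A" for A
    using s1 s2
    by (simp_all add: sound_for_def active_part_def ch_active_def passive_part_def ch_passive_def)
  have "\<not> active_part E1 E2 B" "passive_part E1 E2 B" if "B \<notin> P" for B
    using sound_for_outside[OF s1 that] sound_for_outside[OF s2 that]
    by (simp_all add: active_part_def passive_part_def)
  with assms(3) show ?thesis
    unfolding well_branched_def ch_cond_def act [symmetric] pas [symmetric] by blast
qed

lemma typed_sound:
  assumes "P \<turnstile> G : \<langle>\<phi>, \<Lambda>\<rangle>" "ground G"
  shows "P = participants G \<and> (\<exists>E. sem G = Some E \<and> sound_for P \<phi> \<Lambda> E)"
  using assms
proof (induction rule: typed.induct)
  case t_emp
  then show ?case by (simp add: sound_for_empty)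
next
  case (t_int A B m)
  then show ?case by (simp add: sound_for_int)
next
  case (t_seq P1 G1 \<phi>1 \<Lambda>1 P2 G2 \<phi>2 \<Lambda>2)
  then show ?case using sound_for_seq by fastforce
next
  case (t_par P1 G1 \<phi>1 \<Lambda>1 P2 G2 \<phi>2 \<Lambda>2)
  then obtain E1 E2 where E: "sem G1 = Some E1" "sem G2 = Some E2"
      "sound_for P1 \<phi>1 \<Lambda>1 E1" "sound_for P2 \<phi>2 \<Lambda>2 E2"
    by auto
  \<comment> \<open>A label shared by both sides would have its subject in both \<open>P1\<close>
    and \<open>P2\<close>, which are disjoint; so the parallel composition is defined.\<close>
  have "sbj ` lab E1 ` events E1 \<subseteq> P1" "sbj ` lab E2 ` events E2 \<subseteq> P2"
    using E(3,4) by (auto simp: sound_for_def)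
  then have "lab E1 ` events E1 \<inter> lab E2 ` events E2 = {}"
    using t_par.hyps(3) by blast
  then show ?case using t_par E sound_for_par[OF E(3,4)] by simp
next
  case (t_ch P G1 \<phi>1 \<Lambda>1 G2 \<phi>2 \<Lambda>2)
  then obtain E1 E2 where E: "sem G1 = Some E1" "sem G2 = Some E2"
      "sound_for P \<phi>1 \<Lambda>1 E1" "sound_for P \<phi>2 \<Lambda>2 E2"
    by auto
  then show ?case
    using t_ch sound_for_choice[OF E(3,4)] sound_for_well_branched[OF E(3,4)] by simp
qed

theorem mainTheorem1:
  fixes G :: "('p, 'm) gchor" and P :: "'p set" and \<phi> \<Lambda> :: "('p, 'm) label set"
  assumes "ground G"
    and "\<phi> \<subseteq> labels" and "\<Lambda> \<subseteq> labels"
    and "P \<turnstile> G : \<langle>\<phi>, \<Lambda>\<rangle>"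
  shows "sem G \<noteq> None \<and> P = participants G \<and>
    (\<forall>A\<in>P. restrict_to \<phi> A = min_labels (proj (the (sem G)) A) \<and>
            restrict_to \<Lambda> A = max_labels (proj (the (sem G)) A))"
  using typed_sound[OF assms(4,1)] by (auto simp: sound_for_def)

end
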